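(* For every $\omega\in\mathbb{C}$ with $\operatorname{Re}\omega>-\tfrac32$, $$\nu_\omega=\frac12\int_{-\infty}^{+\infty}\frac{\zeta\big(\tfrac32\pm ix\big)}{\big(\tfrac32\pm ix+\omega\big)\cosh\pi x}\,dx,$$ where $\nu_\omega=\sum_{j=2}^{\infty}(-1)^j\frac{\zeta(j)}{j+\omega}$. The identity holds for either choice of the sign $\pm$ (the same sign being taken in the numerator and in the denominator).
   Context: $\zeta$ denotes the Riemann zeta function. For a complex number $\omega$ that is not an integer $\le -2$, $\nu_\omega$ denotes the sum of the (conditionally convergent) series $$\nu_\omega=\sum_{j=2}^{\infty}(-1)^j\frac{\zeta(j)}{j+\omega}=\lim_{N\to\infty}\sum_{j=2}^{N}(-1)^j\frac{\zeta(j)}{j+\omega}.$$ *)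

theory Defs
  imports "HOL-Analysis.Analysis"
begin

definition dirichlet_zeta :: "complex \<Rightarrow> complex" where
  "dirichlet_zeta s = (\<Sum>n. 1 / of_nat (Suc n) powr s)"

(* The Dirichlet series on its half-plane of convergence, and its unique holomorphic
   continuation to the rest of the plane minus the pole 1. The value 0 at the pole is
   a convention that makes the continuation unique as a total function. *)
definition zeta :: "complex \<Rightarrow> complex" where
  "zeta s = (if Re s > 1 then dirichlet_zeta s
     else (THE f. f holomorphic_on (- {1}) \<and> f 1 = 0 \<and>
             (\<forall>z. Re z > 1 \<longrightarrow> f z = dirichlet_zeta z)) s)"

definition nu_term :: "complex \<Rightarrow> nat \<Rightarrow> complex" where
  "nu_term \<omega> j = (- 1) ^ j * (zeta (of_nat j) / (of_nat j + \<omega>))"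

(* The sum over j >= 2, as an ordered limit of partial sums: the convergence is only
   conditional, so an unordered sum (infsum) would not do. *)
definition nu :: "complex \<Rightarrow> complex" where
  "nu \<omega> = (\<Sum>k. nu_term \<omega> (k + 2))"

end

theory Submission
  imports Defs "HOL-Complex_Analysis.Residue_Theorem" "HOL-Probability.Sinc_Integral"
begin

text \<open>
  No contour shift through the poles of \<open>1 / sin\<close> is needed. On the line of real part \<open>3/2\<close> expand
  \<open>zeta s\<close> as its Dirichlet series and write \<open>1 / (s + \<omega>)\<close> as the Laplace integral of
  \<open>exp (- (s + \<omega>) y)\<close> over \<open>y > 0\<close>. After Fubini the integral over \<open>x\<close> is the Fourier transform of
  \<open>1 / cosh (\<pi> x)\<close>, namely \<open>1 / cosh (y / 2)\<close>, so with \<open>u = exp (- y) / n\<close> the \<open>n\<close>-th summand of the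
  right-hand side is the integral of \<open>exp (- \<omega> y) u\<^sup>2 / (1 + u)\<close>. Expanding this geometrically up to
  \<open>u ^ (M + 1)\<close> and summing over \<open>n\<close> gives the \<open>M\<close>-th partial sum of \<open>\<nu>\<close>; keeping the sum finite avoids
  the merely conditional convergence, and the remainder is at most \<open>zeta 2 / (M + 1/2)\<close>.
\<close>

section \<open>The Fourier transform of \<open>1 / cosh (pi * x)\<close>\<close>

lemma integrable_inverse_cosh_pi: "integrable lborel (\<lambda>x::real. 1 / cosh (pi * x))"
proof -
  \<comment> \<open>The Gudermannian antiderivative has finite limits at both ends, so the
    nonnegative integrand is integrable. This function later dominates every integrand in
    \<open>x\<close>.\<close>
  have d: "((\<lambda>x. arctan (sinh (pi * x)) / pi) has_real_derivative 1 / cosh (pi * x)) (at x)" for x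
  proof -
    have "1 + (sinh (pi * x))\<^sup>2 = (cosh (pi * x))\<^sup>2"
      by (simp add: cosh_square_eq)
    thus ?thesis
      by (auto intro!: derivative_eq_intros simp: power2_eq_square field_simps)
  qed
  have "filterlim (\<lambda>x::real. sinh (pi * x)) at_top at_top"
    by (rule filterlim_compose[OF sinh_real_at_top])
       (rule filterlim_tendsto_pos_mult_at_top[OF tendsto_const pi_gt_zero filterlim_ident])
  hence l1: "((\<lambda>x. arctan (sinh (pi * x)) / pi) \<longlongrightarrow> (pi / 2) / pi) at_top"
    by (intro tendsto_divide tendsto_const filterlim_compose[OF tendsto_arctan_at_top]) auto
  have "filterlim (\<lambda>x::real. sinh (pi * x)) at_bot at_bot"
    by (rule filterlim_compose[OF sinh_real_at_bot])
       (rule filterlim_tendsto_pos_mult_at_bot[OF tendsto_const pi_gt_zero filterlim_ident])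
  hence l2: "((\<lambda>x. arctan (sinh (pi * x)) / pi) \<longlongrightarrow> (- (pi / 2)) / pi) at_bot"
    by (intro tendsto_divide tendsto_const filterlim_compose[OF tendsto_arctan_at_bot]) auto
  have "set_integrable lborel (einterval (-\<infinity>) \<infinity>) (\<lambda>x::real. 1 / cosh (pi * x))"
  proof (rule interval_integral_FTC_nonneg(1)[where F = "\<lambda>x. arctan (sinh (pi * x)) / pi"])
    show "(((\<lambda>x. arctan (sinh (pi * x)) / pi) \<circ> real_of_ereal) \<longlongrightarrow> - (pi / 2) / pi) (at_right (-\<infinity>))"
         "(((\<lambda>x. arctan (sinh (pi * x)) / pi) \<circ> real_of_ereal) \<longlongrightarrow> (pi / 2) / pi) (at_left \<infinity>)"
      using l1 l2 by (simp_all only: ereal_tendsto_simps)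
  qed (use d in \<open>auto intro!: continuous_intros\<close>)
  thus ?thesis
    by (simp add: set_integrable_def)
qed

text \<open>Reverse triangle inequality between \<open>exp z\<close> and \<open>- exp (- z)\<close>.
  The bound is uniform in \<open>Im z\<close>, as the vertical sides of the rectangle
  require.\<close>

lemma norm_cosh_ge: "norm (cosh z) \<ge> sinh \<bar>Re z\<bar>" for z :: complex
proof -
  have "\<bar>norm (exp z) - norm (- exp (- z))\<bar> \<le> norm (exp z - (- exp (- z)))"
    by (rule norm_triangle_ineq3)
  moreover have "2 * sinh \<bar>Re z\<bar> \<le> \<bar>exp (Re z) - exp (- Re z)\<bar>"
    by (auto simp: sinh_field_def abs_if)
  ultimately show ?thesis
    by (simp add: cosh_field_def norm_divide)
qed

text \<open>The zeros are \<open>\<i> * (k + 1/2)\<close> for integers \<open>k\<close>. This open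
  strip is the widest one centred at \<open>\<i> / 2\<close> that contains a single zero; the
  neighbouring ones lie on its boundary.\<close>

lemma cosh_pi_zero_strip:
  fixes z :: complex
  assumes "\<bar>Im z - 1 / 2\<bar> < 1" and "cosh (of_real pi * z) = 0"
  shows "z = \<i> / 2"
proof -
  have "cos (\<i> * (of_real pi * z)) = 0"
    using assms(2) by (simp add: cosh_conv_cos)
  then obtain n :: int where n: "\<i> * (of_real pi * z) = complex_of_real (n * pi) + of_real pi / 2"
    by (auto simp: cos_eq_0)
  have "complex_of_real pi * (\<i> * z) = of_real pi * (of_int n + 1 / 2)"
    using n by (simp add: algebra_simps)
  hence iz: "\<i> * z = of_int n + 1 / 2"
    by (simp only: mult_cancel_left of_real_eq_0_iff pi_neq_zero simp_thms)
  have im: "Im z = - (of_int n + 1 / 2)" and re: "Re z = 0"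
    using arg_cong[OF iz, of Re] arg_cong[OF iz, of Im] by simp_all
  have "-2 < real_of_int n" "real_of_int n < 0"
    using assms(1) im by linarith+
  hence "n = -1"
    by linarith
  thus ?thesis
    using im re by (simp add: complex_eq_iff)
qed

text \<open>
  The integrand is multiplied by \<open>- exp (- y)\<close> under the shift by \<open>\<i>\<close>, and the rectangle of height 1
  encloses the single pole \<open>\<i> / 2\<close>; the bound is that of the two vertical sides.
\<close>
lemma rectangle_integral_sech:
  fixes y R :: real
  assumes R: "R > 0"
  defines "g \<equiv> \<lambda>z::complex. exp (\<i> * of_real y * z) / cosh (of_real pi * z)"
  shows "norm (of_real (1 + exp (- y)) * integral {-R..R} (\<lambda>x. g (of_real x)) - 2 * of_real (exp (- (y / 2))))
           \<le> 2 * exp \<bar>y\<bar> / sinh (pi * R)"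
proof -
  \<comment> \<open>An open convex neighbourhood of every rectangle with
    \<open>0 \<le> Im z \<le> 1\<close>, in which \<open>\<i> / 2\<close> is the only pole of
    \<open>g\<close>.\<close>
  define S where "S = {z::complex. - (1/2) < Im z} \<inter> {z. Im z < 3/2}"
  define a b c d where "a = complex_of_real (-R)" and "b = complex_of_real R" and
    "c = of_real R + \<i>" and "d = of_real (-R) + \<i>"
  have rp: "rectpath a c = linepath a b +++ linepath b c +++ linepath c d +++ linepath d a"
    by (simp add: rectpath_def Let_def a_def b_def c_def d_def Complex_eq)
  have S: "open S" "connected S"
    unfolding S_def
    by (intro open_Int open_halfspace_Im_gt open_halfspace_Im_lt,
        intro convex_connected convex_Int convex_halfspace_Im_gt convex_halfspace_Im_lt)
  have nz: "cosh (of_real pi * z) \<noteq> 0" if "z \<in> S - {\<i>/2}" for z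
    using cosh_pi_zero_strip[of z] that by (auto simp: S_def abs_less_iff)
  have holo: "g holomorphic_on S - {\<i> / 2}"
    unfolding g_def cosh_field_def using nz[unfolded cosh_field_def]
    by (intro holomorphic_intros) auto
  have pim: "path_image (rectpath a c) \<subseteq> S - {\<i> / 2}"
    using R by (subst path_image_rectpath) (auto simp: a_def c_def S_def)
  have cont: "continuous_on (path_image (rectpath a c)) g"
    using holomorphic_on_imp_continuous_on[OF holo] pim continuous_on_subset by blast
  have segs: "continuous_on (closed_segment a b) g" "continuous_on (closed_segment b c) g"
      "continuous_on (closed_segment c d) g" "continuous_on (closed_segment d a) g"
    using cont unfolding rp by (auto simp: path_image_join elim!: continuous_on_subset)
  note ci = segs[THEN contour_integrable_continuous_linepath]
  \<comment> \<open>Reduces the values of \<open>sinh\<close> and \<open>cosh\<close> at the pole to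
    \<open>sin\<close> and \<open>cos\<close> at the real point \<open>- pi / 2\<close>.\<close>
  have rot: "\<i> * (complex_of_real pi * (\<i> / 2)) = of_real (- (pi / 2))"
    by (simp add: complex_eq_iff)
  have sinh_half: "sinh (complex_of_real pi * (\<i> / 2)) = \<i>"
    unfolding sinh_conv_sin rot sin_of_real by simp
  have "contour_integral (rectpath a c) g
      = 2 * pi * \<i> * (\<Sum>p\<in>{\<i>/2}. winding_number (rectpath a c) p * residue g p)"
  proof (rule Residue_theorem[OF S _ holo])
    show "\<forall>z. z \<notin> S \<longrightarrow> winding_number (rectpath a c) z = 0"
      using R by (auto intro!: winding_number_rectpath_outside simp: a_def c_def S_def in_cbox_complex_iff)
  qed (use pim in auto)
  also have "\<dots> = 2 * pi * \<i> * residue g (\<i>/2) * winding_number (rectpath a c) (\<i>/2)"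
    by simp
  also have "winding_number (rectpath a c) (\<i>/2) = 1"
    using R by (intro winding_number_rectpath) (auto simp: a_def c_def in_box_complex_iff)
  \<comment> \<open>Simple pole: numerator over the derivative of the denominator, which is
    \<open>pi * sinh (pi * \<i> / 2) = pi * \<i>\<close>.\<close>
  also have "residue g (\<i>/2) = exp (\<i> * of_real y * (\<i>/2)) / (of_real pi * \<i>)"
    unfolding g_def
  proof (rule residue_simple_pole_deriv[where s = S])
    show "\<i>/2 \<in> S" by (simp add: S_def)
    show "((\<lambda>w. cosh (of_real pi * w)) has_field_derivative of_real pi * \<i>) (at (\<i> / 2))"
      by (rule derivative_eq_intros refl)+ (simp only: sinh_half, simp)
    show "cosh (of_real pi * (\<i> / 2)) = 0"
      unfolding cosh_conv_cos rot cos_of_real by simp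
    show "(\<lambda>w. exp (\<i> * of_real y * w)) holomorphic_on S" "(\<lambda>w. cosh (of_real pi * w)) holomorphic_on S"
      unfolding cosh_field_def by (intro holomorphic_intros; simp)+
  qed (use S in auto)
  finally have total: "contour_integral (rectpath a c) g = 2 * of_real (exp (- (y / 2)))"
    by (simp add: field_simps flip: exp_of_real)
  have ab: "contour_integral (linepath a b) g = integral {-R..R} (\<lambda>x. g (of_real x))"
    using R by (subst contour_integral_linepath_Reals_eq) (auto simp: a_def b_def)
  have shift: "g (z + \<i>) = - of_real (exp (- y)) * g z" for z
  proof -
    have "cosh (of_real pi * (z + \<i>)) = - cosh (of_real pi * z)"
    proof -
      have "exp (of_real pi * (z + \<i>)) = - exp (of_real pi * z)"
           "exp (- (of_real pi * (z + \<i>))) = - exp (- (of_real pi * z))"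
        by (simp_all add: distrib_left exp_add exp_diff)
      thus ?thesis
        by (simp only: cosh_field_def minus_divide_left minus_add_distrib)
    qed
    moreover have "exp (\<i> * of_real y * (z + \<i>)) = of_real (exp (- y)) * exp (\<i> * of_real y * z)"
      by (simp add: algebra_simps exp_add exp_diff exp_minus exp_of_real field_simps)
    ultimately show ?thesis by (simp add: g_def)
  qed
  \<comment> \<open>The top side, run from left to right, is the bottom side translated by
    \<open>\<i>\<close>. The rectangle runs it backwards, which cancels the minus sign from
    \<open>shift\<close>.\<close>
  have "contour_integral (linepath d c) g = contour_integral (linepath a b) (\<lambda>z. g (z + \<i>))"
    unfolding contour_integral_integral by (simp add: linepath_def a_def b_def c_def d_def algebra_simps)
  also have "\<dots> = - of_real (exp (- y)) * contour_integral (linepath a b) g"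
    unfolding shift by (rule contour_integral_lmul[OF ci(1)])
  finally have cd: "contour_integral (linepath c d) g = of_real (exp (- y)) * contour_integral (linepath a b) g"
    using contour_integral_reverse_linepath[OF segs(3)] by simp
  have sum: "contour_integral (rectpath a c) g = contour_integral (linepath a b) g +
     (contour_integral (linepath b c) g + (contour_integral (linepath c d) g + contour_integral (linepath d a) g))"
    unfolding rp using ci by simp
  have bound: "norm (g z) \<le> exp \<bar>y\<bar> / sinh (pi * R)" if "\<bar>Re z\<bar> = R" "0 \<le> Im z" "Im z \<le> 1" for z
  proof -
    have "norm (exp (\<i> * of_real y * z)) \<le> exp \<bar>y\<bar>"
    proof -
      have "\<bar>y * Im z\<bar> \<le> \<bar>y\<bar> * 1"
        unfolding abs_mult using that by (intro mult_left_mono) auto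
      thus ?thesis by simp
    qed
    moreover have "norm (cosh (of_real pi * z)) \<ge> sinh (pi * R)"
      using norm_cosh_ge[of "of_real pi * z"] that by (simp add: abs_mult)
    moreover have "sinh (pi * R) > 0"
      using R by simp
    ultimately show ?thesis
      unfolding g_def norm_divide by (intro frac_le) auto
  qed
  have sp: "sinh (pi * R) > 0"
    using R by simp
  have "norm (contour_integral (linepath b c) g) \<le> exp \<bar>y\<bar> / sinh (pi * R) * norm (c - b)"
    using R sp by (intro contour_integral_bound_linepath ci bound)
                (auto simp: b_def c_def closed_segment_same_Re closed_segment_eq_real_ivl)
  moreover have "norm (contour_integral (linepath d a) g) \<le> exp \<bar>y\<bar> / sinh (pi * R) * norm (a - d)"
    using R sp by (intro contour_integral_bound_linepath ci bound)
                (auto simp: a_def d_def closed_segment_same_Re closed_segment_eq_real_ivl)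
  moreover have "norm (c - b) = 1" "norm (a - d) = 1"
    by (simp_all add: a_def b_def c_def d_def)
  ultimately have "norm (- (contour_integral (linepath b c) g + contour_integral (linepath d a) g))
      \<le> exp \<bar>y\<bar> / sinh (pi * R) + exp \<bar>y\<bar> / sinh (pi * R)"
    unfolding norm_minus_cancel by (intro norm_triangle_mono) auto
  \<comment> \<open>The horizontal sides together give \<open>1 + exp (- y)\<close> times the
    integral, so the deviation from the residue is exactly minus the vertical sides.\<close>
  moreover have "of_real (1 + exp (- y)) * integral {-R..R} (\<lambda>x. g (of_real x)) - 2 * of_real (exp (- (y / 2)))
     = - (contour_integral (linepath b c) g + contour_integral (linepath d a) g)"
    using sum[unfolded total cd ab] by (simp add: algebra_simps)
  ultimately show ?thesis
    by (simp only: mult_2 add_divide_distrib distrib_right)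
qed

lemma integrable_exp_sech:
  "integrable lborel (\<lambda>x::real. exp (\<i> * of_real y * of_real x) / of_real (cosh (pi * x)))"
  by (rule Bochner_Integration.integrable_bound[OF integrable_inverse_cosh_pi])
     (auto simp: norm_divide intro!: borel_measurable_continuous_onI continuous_intros)

text \<open>As \<open>R\<close> grows the vertical sides vanish, leaving
  \<open>(1 + exp (- y)) * I = 2 * exp (- (y / 2))\<close> for the full integral
  \<open>I\<close>.\<close>

lemma fourier_sech:
  "(LINT x|lborel. exp (\<i> * of_real y * of_real x) / of_real (cosh (pi * x))) = of_real (1 / cosh (y / 2))"
proof -
  define f where "f = (\<lambda>x::real. exp (\<i> * of_real y * of_real x) / of_real (cosh (pi * x)) :: complex)"
  note int = integrable_exp_sech[of y, folded f_def]
  have [measurable]: "f \<in> borel_measurable borel"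
    using int by (auto dest: borel_measurable_integrable)
  define J where "J R = integral {-R..R} f" for R :: real
  have J_eq: "J R = (LINT x|lborel. indicator {-R..R} x *\<^sub>R f x)" for R
  proof -
    have "set_integrable lborel {-R..R} f"
      unfolding set_integrable_def by (rule integrable_mult_indicator[OF _ int]) auto
    from set_borel_integral_eq_integral(2)[OF this] show ?thesis
      by (simp add: J_def set_lebesgue_integral_def)
  qed
  \<comment> \<open>Dominated convergence identifies the limit of the symmetric truncations with the
    Lebesgue integral.\<close>
  have lim1: "(J \<longlongrightarrow> (LINT x|lborel. f x)) at_top"
    unfolding J_eq
  proof (rule integral_dominated_convergence_at_top[where w = "\<lambda>x. norm (f x)"])
    show "AE x in lborel. ((\<lambda>R. indicator {-R..R} x *\<^sub>R f x) \<longlongrightarrow> f x) at_top"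
    proof (rule AE_I2)
      fix x :: real
      show "((\<lambda>R. indicator {-R..R} x *\<^sub>R f x) \<longlongrightarrow> f x) at_top"
        by (rule tendsto_eventually, rule eventually_mono[OF eventually_ge_at_top[of "\<bar>x\<bar>"]])
           (auto simp: indicator_def)
    qed
  qed (use int in \<open>auto simp: indicator_def\<close>)
  have "((\<lambda>R. of_real (1 + exp (- y)) * J R - 2 * of_real (exp (- (y / 2)))) \<longlongrightarrow> 0) at_top"
  proof (rule Lim_null_comparison)
    show "eventually (\<lambda>R. norm (of_real (1 + exp (- y)) * J R - 2 * of_real (exp (- (y / 2))))
       \<le> 2 * exp \<bar>y\<bar> / sinh (pi * R)) at_top"
      using eventually_gt_at_top[of 0]
    proof eventually_elim
      case (elim R)
      have f_eq: "f = (\<lambda>x. exp (\<i> * of_real y * of_real x) / cosh (of_real pi * complex_of_real x))"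
        by (simp add: f_def fun_eq_iff cosh_field_def flip: exp_of_real)
      show ?case
        using rectangle_integral_sech[OF elim, of y] by (simp add: J_def f_eq)
    qed
    show "((\<lambda>R. 2 * exp \<bar>y\<bar> / sinh (pi * R)) \<longlongrightarrow> 0) at_top"
      by (intro tendsto_divide_0[OF tendsto_const] filterlim_at_top_imp_at_infinity
            filterlim_compose[OF sinh_real_at_top]
            filterlim_tendsto_pos_mult_at_top[OF tendsto_const pi_gt_zero filterlim_ident])
  qed
  moreover have "((\<lambda>R. of_real (1 + exp (- y)) * J R - 2 * of_real (exp (- (y / 2)))) \<longlongrightarrow>
      of_real (1 + exp (- y)) * (LINT x|lborel. f x) - 2 * of_real (exp (- (y / 2)))) at_top"
    by (intro tendsto_intros lim1)
  ultimately have eq: "of_real (1 + exp (- y)) * (LINT x|lborel. f x) - 2 * of_real (exp (- (y / 2))) = 0"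
    using tendsto_unique trivial_limit_at_top_linorder by blast
  have pos: "1 + exp (- y) \<noteq> 0"
    by (simp add: add_pos_pos less_imp_neq[symmetric])
  have "(LINT x|lborel. f x) = of_real (2 * exp (- (y / 2)) / (1 + exp (- y)))"
    using eq pos unfolding of_real_divide of_real_mult by (simp add: nonzero_eq_divide_eq mult.commute del: of_real_add)
  also have "2 * exp (- (y / 2)) / (1 + exp (- y)) = 1 / cosh (y / 2)"
  proof -
    have "exp (- y) = exp (- (y / 2)) * exp (- (y / 2))" "exp (y / 2) * exp (- (y / 2)) = 1"
      by (simp_all flip: exp_add)
    hence "2 * exp (- (y / 2)) * cosh (y / 2) = 1 + exp (- y)"
      by (simp add: cosh_field_def algebra_simps)
    thus ?thesis
      using pos by (simp add: field_simps)
  qed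
  finally show ?thesis
    by (simp add: f_def)
qed

section \<open>Laplace integrals and the terms of the Dirichlet series\<close>

text \<open>Fundamental theorem with antiderivative \<open>- exp (- c * y) / c\<close>, which
  vanishes at infinity because \<open>Re c > 0\<close>. It is used for
  \<open>c = s + \<omega>\<close> with \<open>Re s = 3/2\<close> and for
  \<open>c = j + \<omega>\<close> with integer \<open>j \<ge> 2\<close>; in both cases
  \<open>Re \<omega> > - 3/2\<close> makes \<open>Re c\<close> positive.\<close>

lemma laplace_exp:
  fixes c :: complex
  assumes "Re c > 0"
  shows "set_integrable lborel {0<..} (\<lambda>y. exp (- (c * of_real y)))"
    and "(LINT y:{0<..}|lborel. exp (- (c * of_real y))) = 1 / c"
proof -
  show int: "set_integrable lborel {0<..} (\<lambda>y. exp (- (c * of_real y)))"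
    unfolding set_integrable_def
  proof (rule Bochner_Integration.integrable_bound)
    show "integrable lborel (\<lambda>y. indicator {0<..} y *\<^sub>R exp (- (y * Re c)))"
      using integrable_I0i_exp_mscale[OF assms] by (simp add: set_integrable_def)
  qed (auto simp: indicator_def mult.commute)
  have c: "c \<noteq> 0"
    using assms by auto
  have "(LBINT y=0..\<infinity>. exp (- (c * of_real y))) = 0 - (- (1 / c))"
  proof (rule interval_integral_FTC_integrable[where F = "\<lambda>y. - (exp (- (c * of_real y)) / c)"])
    show "((\<lambda>y. - (exp (- (c * of_real y)) / c)) has_vector_derivative exp (- (c * of_real x))) (at x)" for x :: real
    proof -
      have "((\<lambda>y. - (exp (- (c * y)) / c)) has_field_derivative exp (- (c * of_real x))) (at (of_real x))"
        using c by (auto intro!: derivative_eq_intros)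
      from has_vector_derivative_real_field[OF this] show ?thesis .
    qed
    have "((\<lambda>y::real. - (exp (- (c * of_real y)) / c)) \<longlongrightarrow> - (exp (- (c * of_real 0)) / c)) (at_right 0)"
      by (intro tendsto_intros c)
    thus "((((\<lambda>y. - (exp (- (c * of_real y)) / c))) \<circ> real_of_ereal) \<longlongrightarrow> - (1 / c)) (at_right 0)"
      unfolding zero_ereal_def by (simp add: ereal_tendsto_simps)
    have "((\<lambda>y::real. - (exp (- (c * of_real y)) / c)) \<longlongrightarrow> 0) at_top"
    proof (rule tendsto_norm_zero_cancel)
      have "filterlim (\<lambda>y. - (Re c * y)) at_bot at_top"
        using filterlim_tendsto_pos_mult_at_top[OF tendsto_const assms filterlim_ident]
        by (simp add: filterlim_uminus_at_top)
      hence "((\<lambda>y. exp (- (Re c * y)) / norm c) \<longlongrightarrow> 0 / norm c) at_top"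
        using c by (intro tendsto_divide tendsto_const filterlim_compose[OF exp_at_bot]) auto
      thus "((\<lambda>y. norm (- (exp (- (c * of_real y)) / c))) \<longlongrightarrow> 0) at_top"
        by (simp add: norm_divide)
    qed
    thus "((((\<lambda>y. - (exp (- (c * of_real y)) / c))) \<circ> real_of_ereal) \<longlongrightarrow> 0) (at_left \<infinity>)"
      by (simp add: ereal_tendsto_simps)
    show "set_integrable lborel (einterval 0 \<infinity>) (\<lambda>y. exp (- (c * of_real y)))"
      using int by (simp add: zero_ereal_def)
  qed (auto intro!: continuous_intros)
  thus "(LINT y:{0<..}|lborel. exp (- (c * of_real y))) = 1 / c"
    by (simp add: interval_lebesgue_integral_def zero_ereal_def)
qed

text \<open>The Dirichlet term of the integer \<open>n + 1\<close>, that is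
  \<open>(n + 1) powr (- s)\<close>. The exponential form with a real logarithm lets it merge with
  the Laplace kernel by adding exponents.\<close>

definition zeta_summand :: "nat \<Rightarrow> complex \<Rightarrow> complex" where
  "zeta_summand n s = exp (- (s * of_real (ln (real (Suc n)))))"

lemma norm_zeta_summand: "norm (zeta_summand n s) = real (Suc n) powr (- Re s)"
  by (simp add: zeta_summand_def powr_def)

lemma summable_norm_zeta_summand: "Re s > 1 \<Longrightarrow> summable (\<lambda>n. norm (zeta_summand n s))"
  unfolding norm_zeta_summand by (subst summable_Suc_iff) (simp add: summable_real_powr_iff)

text \<open>For \<open>Re s > 1\<close> the first branch of \<open>zeta\<close> applies. All
  arguments that occur, on the line \<open>Re s = 3/2\<close> and at integers at least 2, lie in
  this half-plane.\<close>

lemma zeta_sums: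
  assumes "Re s > 1"
  shows "(\<lambda>n. zeta_summand n s) sums zeta s"
proof -
  have "1 / of_nat (Suc n) powr s = zeta_summand n s" for n
  proof -
    have "Ln (of_nat (Suc n)) = of_real (ln (real (Suc n)))"
      by (metis Ln_of_real of_nat_0_less_iff of_real_of_nat_eq zero_less_Suc)
    thus ?thesis
      by (simp add: zeta_summand_def powr_def exp_minus field_simps del: of_nat_Suc)
  qed
  hence "zeta s = (\<Sum>n. zeta_summand n s)"
    using assms by (simp add: zeta_def dirichlet_zeta_def)
  thus ?thesis
    using summable_norm_zeta_summand[OF assms, THEN summable_norm_cancel] by (simp add: summable_sums)
qed

lemma borel_measurable_cosh_pi [measurable]: "(\<lambda>x::real. cosh (pi * x)) \<in> borel_measurable borel"
  by (intro borel_measurable_continuous_onI continuous_intros)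

section \<open>The contribution of a single Dirichlet term\<close>

text \<open>One double integral evaluated in both orders: integrating over \<open>y\<close> first
  gives the Laplace value \<open>1 / (s x + \<omega>)\<close>, integrating over \<open>x\<close>
  first gives the Fourier transform of \<open>1 / cosh (pi * x)\<close>.\<close>

lemma mellin_barnes_summand:
  fixes \<omega> :: complex and \<sigma> :: real and n :: nat
  assumes \<omega>: "Re \<omega> > - 3 / 2" and \<sigma>: "\<sigma> = 1 \<or> \<sigma> = - 1"
  defines "s \<equiv> \<lambda>x. 3 / 2 + of_real \<sigma> * \<i> * complex_of_real x"
  defines "u \<equiv> \<lambda>y. exp (- (y + ln (real (Suc n))))"
  shows "1 / 2 * (LINT x|lborel. zeta_summand n (s x) / ((s x + \<omega>) * of_real (cosh (pi * x)))) =
    (LINT y:{0<..}|lborel. exp (- (\<omega> * of_real y)) * of_real ((u y)\<^sup>2 / (1 + u y)))"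
proof -
  define L where "L = ln (real (Suc n))"
  define K where "K = (\<lambda>x y. indicator {0<..} y *\<^sub>R
     (exp (- (s x * of_real (y + L))) * exp (- (\<omega> * of_real y)) / of_real (cosh (pi * x))))"
  have K1: "K x y = zeta_summand n (s x) / of_real (cosh (pi * x)) *
                  (indicator {0<..} y *\<^sub>R exp (- ((s x + \<omega>) * of_real y)))" for x y
    by (simp add: K_def zeta_summand_def L_def algebra_simps exp_add exp_diff exp_minus indicator_def field_simps)
  \<comment> \<open>Isolates the dependence on \<open>x\<close>: a pure oscillation of frequency
    \<open>- \<sigma> * (y + L)\<close> over \<open>cosh (pi * x)\<close>, ready for
    \<open>fourier_sech\<close>.\<close>
  have K2: "K x y = (indicator {0<..} y *\<^sub>R exp (- (\<omega> * of_real y)) * of_real (exp (- (3 / 2 * (y + L))))) *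
      (exp (\<i> * of_real (- \<sigma> * (y + L)) * of_real x) / of_real (cosh (pi * x)))" for x y
  proof -
    have eq: "exp (- (s x * of_real (y + L))) * exp (- (\<omega> * of_real y)) =
        exp (- (\<omega> * of_real y)) * of_real (exp (- (3 / 2 * (y + L)))) *
        exp (\<i> * of_real (- \<sigma> * (y + L)) * of_real x)"
      unfolding exp_of_real[symmetric] exp_add[symmetric]
      by (rule arg_cong[of _ _ exp]) (simp add: s_def field_simps)
    show ?thesis
      unfolding K_def eq by (simp only: divide_inverse mult_scaleR_left mult.assoc)
  qed
  \<comment> \<open>The modulus is a product of a function of \<open>x\<close> and one of
    \<open>y\<close>, with decay rate \<open>3/2 + Re \<omega> > 0\<close> in \<open>y\<close>; this
    makes Fubini applicable.\<close>
  have norm_K: "norm (K x y) =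
      exp (- (3 / 2 * L)) / cosh (pi * x) * (indicator {0<..} y *\<^sub>R exp (- (y * (3 / 2 + Re \<omega>))))" for x y
  proof -
    have "exp (- (3 / 2 * (y + L))) * exp (- (Re \<omega> * y)) = exp (- (3 / 2 * L)) * exp (- (y * (3 / 2 + Re \<omega>)))"
      unfolding exp_add[symmetric] by (rule arg_cong[of _ _ exp]) (simp add: algebra_simps)
    thus ?thesis
      by (simp add: K_def s_def norm_mult norm_divide indicator_def)
  qed
  have re: "Re (s x + \<omega>) > 0" for x
    using \<omega> by (simp add: s_def)
  note lap = laplace_exp[OF re, unfolded set_integrable_def set_lebesgue_integral_def]
  have "integrable (lborel \<Otimes>\<^sub>M lborel) (case_prod K)"
  proof (rule lborel_pair.Fubini_integrable)
    show "case_prod K \<in> borel_measurable (lborel \<Otimes>\<^sub>M lborel)"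
      unfolding K_def s_def by measurable
    show "integrable lborel (\<lambda>x. LINT y|lborel. norm (case (x, y) of (x, y) \<Rightarrow> K x y))"
      unfolding prod.case norm_K integral_mult_right_zero
      by (intro integrable_mult_left) (use integrable_mult_right[OF integrable_inverse_cosh_pi] in \<open>simp\<close>)
    show "AE x in lborel. integrable lborel (\<lambda>y. case (x, y) of (x, y) \<Rightarrow> K x y)"
      unfolding prod.case K1 by (intro AE_I2 integrable_mult_right lap)
  qed
  from lborel_pair.Fubini_integral[OF this]
  have swap: "(LINT x|lborel. LINT y|lborel. K x y) = (LINT y|lborel. LINT x|lborel. K x y)" ..
  have inner_y: "(LINT y|lborel. K x y) = zeta_summand n (s x) / ((s x + \<omega>) * of_real (cosh (pi * x)))" for x
    unfolding K1 integral_mult_right_zero lap(2) by simp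
  have inner_x: "1 / 2 * (LINT x|lborel. K x y) =
      indicator {0<..} y *\<^sub>R (exp (- (\<omega> * of_real y)) * of_real ((u y)\<^sup>2 / (1 + u y)))" for y
  proof -
    define Y where "Y = y + L"
    \<comment> \<open>Evenness of \<open>cosh\<close> makes the result independent of the sign
      \<open>\<sigma>\<close>.\<close>
    have c: "cosh (- \<sigma> * Y / 2) = cosh (Y / 2)"
      using \<sigma> by auto
    \<comment> \<open>With \<open>v = exp (- Y / 2)\<close> this reads
      \<open>v^3 / (v + 1/v) = v^4 / (1 + v^2)\<close>, where \<open>v^2 = u y\<close>. The factor 2
      is the prefactor \<open>1 / 2\<close> of the integral.\<close>
    have "exp (- (3 / 2 * Y)) / (2 * cosh (Y / 2)) = (u y)\<^sup>2 / (1 + u y)"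
    proof -
      define v where "v = exp (- (Y / 2))"
      have v: "v > 0" "exp (Y / 2) = 1 / v"
        by (simp_all add: v_def exp_minus inverse_eq_divide)
      have v3: "exp (- (3 / 2 * Y)) = v ^ 3" and v2: "u y = v ^ 2"
        unfolding v_def exp_of_nat_mult[symmetric] by (simp_all add: u_def Y_def L_def field_simps)
      have nz: "1 + v * v \<noteq> 0"
        using mult_pos_pos[OF v(1) v(1)] by linarith
      have "cosh (Y / 2) = (1 / v + v) / 2"
        unfolding cosh_field_def v(2) by (simp add: v_def)
      thus ?thesis
        unfolding v3 v2 using v(1) nz by (simp add: field_simps power2_eq_square power3_eq_cube)
    qed
    from arg_cong[OF this, of complex_of_real]
    have "complex_of_real (exp (- (3 / 2 * Y))) / (2 * of_real (cosh (Y / 2))) = of_real ((u y)\<^sup>2 / (1 + u y))"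
      by simp
    thus ?thesis
      unfolding K2 integral_mult_right_zero fourier_sech Y_def[symmetric] c
      by (simp add: scaleR_conv_of_real field_simps)
  qed
  have "1 / 2 * (LINT x|lborel. zeta_summand n (s x) / ((s x + \<omega>) * of_real (cosh (pi * x)))) =
      1 / 2 * (LINT y|lborel. LINT x|lborel. K x y)"
    unfolding inner_y[symmetric] swap ..
  also have "\<dots> = (LINT y|lborel. 1 / 2 * (LINT x|lborel. K x y))"
    by (rule integral_mult_right_zero[symmetric])
  finally show ?thesis
    unfolding inner_x set_lebesgue_integral_def .
qed

section \<open>Finite geometric expansion with an explicit error\<close>

lemma geometric_remainder:
  fixes u :: real
  assumes "u \<ge> 0"
  shows "u\<^sup>2 / (1 + u) - (\<Sum>k<M. (- 1) ^ k * u ^ (k + 2)) = (- 1) ^ M * u ^ (M + 2) / (1 + u)"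
proof (induction M)
  case (Suc M)
  have "u\<^sup>2 / (1 + u) - (\<Sum>k<Suc M. (- 1) ^ k * u ^ (k + 2)) = (- 1) ^ M * u ^ (M + 2) / (1 + u) - (- 1) ^ M * u ^ (M + 2)"
    using Suc by simp
  also have "\<dots> = (- 1) ^ Suc M * u ^ (Suc M + 2) / (1 + u)"
    using assms by (simp add: field_simps add_nonneg_eq_0_iff)
  finally show ?case .
qed (simp add: power2_eq_square)

text \<open>The power \<open>u ^ j\<close> integrates to
  \<open>(n + 1) powr (- j) / (j + \<omega>)\<close>, the share of \<open>n + 1\<close> in the term
  of index \<open>j\<close>. The remainder is at most \<open>u ^ (M + 2)\<close>; its bound must be
  summable over \<open>n\<close> and tend to 0 with \<open>M\<close>.\<close>

lemma laplace_geometric_remainder: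
  fixes \<omega> :: complex and n M :: nat
  assumes \<omega>: "Re \<omega> > - 3 / 2"
  defines "u \<equiv> \<lambda>y. exp (- (y + ln (real (Suc n))))"
  shows "norm ((LINT y:{0<..}|lborel. exp (- (\<omega> * of_real y)) * of_real ((u y)\<^sup>2 / (1 + u y))) -
      (\<Sum>k<M. (- 1) ^ k * (zeta_summand n (of_nat (k + 2)) / (of_nat (k + 2) + \<omega>))))
    \<le> real (Suc n) powr - 2 / (real M + 1 / 2)"
proof -
  have pw: "complex_of_real (u y ^ j) * exp (- (\<omega> * of_real y)) =
      zeta_summand n (of_nat j) * exp (- ((of_nat j + \<omega>) * of_real y))" for y j
  proof -
    have u_pow: "u y ^ j = exp (real j * - (y + ln (real (Suc n))))"
      unfolding u_def by (rule exp_of_nat_mult[symmetric])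
    show ?thesis
      unfolding u_pow zeta_summand_def exp_of_real[symmetric] exp_add[symmetric]
      by (rule arg_cong[of _ _ exp]) (simp add: algebra_simps)
  qed
  have re: "Re (of_nat (k + 2) + \<omega>) > 0" for k
    using \<omega> by simp
  note lap = laplace_exp[OF re, unfolded set_integrable_def set_lebesgue_integral_def]
  define P where "P j y = indicator {0<..} y *\<^sub>R (complex_of_real (u y ^ j) * exp (- (\<omega> * of_real y)))" for j y
  have P: "P j y = zeta_summand n (of_nat j) * (indicator {0<..} y *\<^sub>R exp (- ((of_nat j + \<omega>) * of_real y)))" for j y
    unfolding P_def pw by simp
  have P_int: "integrable lborel (P (k + 2))" for k
    unfolding P by (intro integrable_mult_right lap)
  have P_val: "(LINT y|lborel. P (k + 2) y) = zeta_summand n (of_nat (k + 2)) / (of_nat (k + 2) + \<omega>)" for k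
    unfolding P integral_mult_right_zero lap(2) by simp
  define F where "F y = indicator {0<..} y *\<^sub>R (exp (- (\<omega> * of_real y)) * complex_of_real ((u y)\<^sup>2 / (1 + u y)))" for y
  have u: "u y > 0" for y by (simp add: u_def)
  have norm_1u: "norm (1 + complex_of_real (u y)) = 1 + u y" for y
    using u[of y] by (metis norm_of_real of_real_1 of_real_add abs_of_pos add_pos_pos zero_less_one)
  have F_int: "integrable lborel F"
  \<comment> \<open>\<open>F\<close> is dominated by the square term because
    \<open>u^2 / (1 + u) \<le> u^2\<close>.\<close>
  proof (rule Bochner_Integration.integrable_bound[OF P_int[of 0]])
    show "F \<in> borel_measurable lborel"
      unfolding F_def u_def by measurable
    have "norm (F y) \<le> norm (P (0 + 2) y)" for y
    proof -
      have "(u y)\<^sup>2 / (1 + u y) \<le> (u y)\<^sup>2"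
        using u[of y] by (simp add: field_simps)
      from mult_right_mono[OF this, of "exp (- (Re \<omega> * y))"] show ?thesis
        by (simp add: F_def P_def indicator_def norm_mult norm_divide norm_power norm_1u abs_of_pos[OF u] power2_eq_square mult_ac)
    qed
    thus "AE y in lborel. norm (F y) \<le> norm (P (0 + 2) y)" by (rule AE_I2)
  qed
  \<comment> \<open>In \<open>y\<close> the rate is
    \<open>M + 2 + Re \<omega> \<ge> M + 1/2\<close>. In \<open>n\<close> the exponent
    \<open>M + 2\<close> is weakened to 2, so that the sum over \<open>n\<close> is bounded
    independently of \<open>M\<close>.\<close>
  have le: "norm (F y - (\<Sum>k<M. (- 1) ^ k * P (k + 2) y))
      \<le> indicator {0<..} y *\<^sub>R (real (Suc n) powr - 2 * exp (- (y * (real M + 1 / 2))))" for y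
  proof (cases "y > 0")
    case True
    define L where "L = ln (real (Suc n))"
    have L: "L \<ge> 0" "real (Suc n) powr - 2 = exp (- 2 * L)"
      by (simp_all add: L_def powr_def)
    have "F y - (\<Sum>k<M. (- 1) ^ k * P (k + 2) y) =
        exp (- (\<omega> * of_real y)) * of_real ((u y)\<^sup>2 / (1 + u y) - (\<Sum>k<M. (- 1) ^ k * u y ^ (k + 2)))"
      using True by (simp add: F_def P_def sum_distrib_left algebra_simps)
    also have "norm \<dots> = exp (- (Re \<omega> * y)) * (u y ^ (M + 2) / (1 + u y))"
      unfolding geometric_remainder[OF less_imp_le[OF u]] using u[of y]
      by (simp add: norm_mult norm_divide norm_power norm_1u)
    also have "\<dots> \<le> exp (- (Re \<omega> * y)) * (u y ^ (M + 2))"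
      using u[of y] by (intro mult_left_mono) (auto simp: field_simps)
    also have "\<dots> = exp (- (Re \<omega> * y) - (real M + 2) * (y + L))"
    proof -
      have u_pow: "u y ^ (M + 2) = exp (real (M + 2) * - (y + L))"
        unfolding u_def L_def by (rule exp_of_nat_mult[symmetric])
      show ?thesis
        unfolding u_pow exp_add[symmetric] by (rule arg_cong[of _ _ exp]) (simp add: algebra_simps)
    qed
    also have "\<dots> \<le> exp (- 2 * L - y * (real M + 1 / 2))"
    proof -
      have "real M * L \<ge> 0" "(Re \<omega> + 3 / 2) * y \<ge> 0"
        using L \<omega> True by auto
      thus ?thesis by (simp add: algebra_simps)
    qed
    also have "\<dots> = real (Suc n) powr - 2 * exp (- (y * (real M + 1 / 2)))"
      unfolding L exp_add[symmetric] by (rule arg_cong[of _ _ exp]) simp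
    finally show ?thesis
      using True by simp
  qed (simp add: F_def P_def)
  have pos: "real M + 1 / 2 > 0" by simp
  have G_int: "integrable lborel (\<lambda>y. indicator {0<..} y *\<^sub>R (real (Suc n) powr - 2 * exp (- (y * (real M + 1 / 2)))))"
    using integrable_mult_right[OF integrable_I0i_exp_mscale[OF pos, unfolded set_integrable_def], of "real (Suc n) powr - 2"]
    by (simp add: mult_ac)
  have "(LINT y|lborel. F y) - (\<Sum>k<M. (- 1) ^ k * (zeta_summand n (of_nat (k + 2)) / (of_nat (k + 2) + \<omega>)))
      = (LINT y|lborel. F y - (\<Sum>k<M. (- 1) ^ k * P (k + 2) y))"
    unfolding P_val[symmetric] using F_int P_int
    by (simp add: Bochner_Integration.integral_diff Bochner_Integration.integral_sum)
  also have "norm \<dots> \<le> (LINT y|lborel. indicator {0<..} y *\<^sub>R (real (Suc n) powr - 2 * exp (- (y * (real M + 1 / 2)))))"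
    by (rule Bochner_Integration.integral_norm_bound_integral[OF _ G_int le]) (use F_int P_int in auto)
  also have "\<dots> = real (Suc n) powr - 2 / (real M + 1 / 2)"
  proof -
    have "(LINT y|lborel. indicator {0<..} y * exp (- (y * (real M + 1 / 2)))) = 1 / (real M + 1 / 2)"
      using LBINT_I0i_exp_mscale[OF pos]
      by (simp add: interval_lebesgue_integral_def set_lebesgue_integral_def zero_ereal_def)
    thus ?thesis
      using integral_mult_right_zero[of lborel "real (Suc n) powr - 2" "\<lambda>y. indicator {0<..} y * exp (- (y * (real M + 1 / 2)))"]
      by (simp add: mult_ac)
  qed
  finally show ?thesis
    by (simp add: F_def set_lebesgue_integral_def)
qed

section \<open>Summation over the Dirichlet series and the limit\<close>

text \<open>On the line \<open>Re s = 3/2\<close> the terms are bounded by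
  \<open>(n + 1) powr (- 3/2)\<close> times a multiple of \<open>1 / cosh (pi * x)\<close>: summable
  in \<open>n\<close> since \<open>3/2 > 1\<close>, and integrable in \<open>x\<close>.\<close>

lemma integral_zeta_termwise:
  fixes \<omega> :: complex and \<sigma> :: real
  assumes \<omega>: "Re \<omega> > - 3 / 2"
  defines "s \<equiv> \<lambda>x. 3 / 2 + of_real \<sigma> * \<i> * complex_of_real x"
  defines "f \<equiv> \<lambda>n x. zeta_summand n (s x) / ((s x + \<omega>) * of_real (cosh (pi * x)))"
  defines "g \<equiv> \<lambda>x. zeta (s x) / ((s x + \<omega>) * of_real (cosh (pi * x)))"
  shows "integrable lborel g" and "(\<lambda>n. LINT x|lborel. f n x) sums (LINT x|lborel. g x)"
proof -
  have re: "Re (s x) = 3 / 2" for x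
    by (simp add: s_def)
  have f_sums: "(\<lambda>n. f n x) sums g x" for x
    unfolding f_def g_def by (intro sums_divide zeta_sums) (simp add: re)
  \<comment> \<open>Bounds \<open>1 / norm (s x + \<omega>)\<close> for all \<open>x\<close>, since
    a modulus is at least the real part.\<close>
  define C where "C = 1 / (3 / 2 + Re \<omega>)"
  have bound: "norm (f n x) \<le> real (Suc n) powr (- 3 / 2) * C * (1 / cosh (pi * x))" for n x
  proof -
    have "3 / 2 + Re \<omega> \<le> norm (s x + \<omega>)"
      using complex_Re_le_cmod[of "s x + \<omega>"] by (simp add: re)
    thus ?thesis
      using \<omega> by (simp add: f_def C_def norm_divide norm_mult norm_zeta_summand re divide_simps del: of_nat_Suc)
  qed
  have summ: "summable (\<lambda>n. real (Suc n) powr (- 3 / 2))"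
    by (subst summable_Suc_iff) (simp add: summable_real_powr_iff)
  have f_int: "integrable lborel (f n)" for n
  proof (rule Bochner_Integration.integrable_bound[OF integrable_mult_right[OF integrable_inverse_cosh_pi]])
    show "f n \<in> borel_measurable lborel"
      unfolding f_def s_def zeta_summand_def by measurable
    show "AE x in lborel. norm (f n x) \<le> norm (real (Suc n) powr (- 3 / 2) * C * (1 / cosh (pi * x)))"
      unfolding real_norm_def by (intro AE_I2 order_trans[OF bound abs_ge_self])
  qed
  have ae: "AE x in lborel. summable (\<lambda>n. norm (f n x))"
  proof (rule AE_I2)
    fix x :: real
    have "summable (\<lambda>n. real (Suc n) powr (- 3 / 2) * C * (1 / cosh (pi * x)))"
      by (intro summable_mult2 summ)
    thus "summable (\<lambda>n. norm (f n x))"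
      by (rule summable_comparison_test') (use bound in simp)
  qed
  have si: "summable (\<lambda>n. LINT x|lborel. norm (f n x))"
  proof (rule summable_comparison_test')
    show "summable (\<lambda>n. real (Suc n) powr (- 3 / 2) * C * (LINT x|lborel. 1 / cosh (pi * x)))"
      by (intro summable_mult2 summ)
    show "norm (LINT x|lborel. norm (f n x)) \<le> real (Suc n) powr (- 3 / 2) * C * (LINT x|lborel. 1 / cosh (pi * x))" for n
    proof -
      have "(LINT x|lborel. norm (f n x)) \<le> (LINT x|lborel. real (Suc n) powr (- 3 / 2) * C * (1 / cosh (pi * x)))"
        by (intro integral_mono integrable_norm f_int integrable_mult_right integrable_inverse_cosh_pi bound)
      thus ?thesis
        unfolding integral_mult_right_zero by simp
    qed
  qed
  have "(\<Sum>n. f n x) = g x" for x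
    using f_sums sums_unique by metis
  thus "integrable lborel g" "(\<lambda>n. LINT x|lborel. f n x) sums (LINT x|lborel. g x)"
    using integrable_suminf[OF f_int ae si] sums_integral[OF f_int ae si] by simp_all
qed

text \<open>Infinite sums and integrals are total functions here, so summability and integrability
  are asserted along with the identity; \<open>\<sigma>\<close> carries the choice of sign.\<close>

theorem theorem2:
  fixes \<omega> :: complex and \<sigma> :: real
  assumes "Re \<omega> > - 3 / 2" and "\<sigma> = 1 \<or> \<sigma> = - 1"
  shows "summable (\<lambda>k. nu_term \<omega> (k + 2)) \<and>
    integrable lborel (\<lambda>x::real. zeta (3 / 2 + of_real \<sigma> * \<i> * of_real x) /
      ((3 / 2 + of_real \<sigma> * \<i> * of_real x + \<omega>) * of_real (cosh (pi * x)))) \<and>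
    nu \<omega> = 1 / 2 * (LINT x|lborel. zeta (3 / 2 + of_real \<sigma> * \<i> * of_real x) /
      ((3 / 2 + of_real \<sigma> * \<i> * of_real x + \<omega>) * of_real (cosh (pi * x))))"
proof -
  define J where "J = (LINT x|lborel. zeta (3 / 2 + of_real \<sigma> * \<i> * of_real x) /
      ((3 / 2 + of_real \<sigma> * \<i> * of_real x + \<omega>) * of_real (cosh (pi * x))))"
  define T where "T n = 1 / 2 * (LINT x|lborel. zeta_summand n (3 / 2 + of_real \<sigma> * \<i> * of_real x) /
      ((3 / 2 + of_real \<sigma> * \<i> * of_real x + \<omega>) * of_real (cosh (pi * x))))" for n
  define Z where "Z = (\<Sum>n. real (Suc n) powr - 2)"
  have Z: "(\<lambda>n. real (Suc n) powr - 2) sums Z"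
    unfolding Z_def by (rule summable_sums, subst summable_Suc_iff) (simp add: summable_real_powr_iff)
  have T: "T sums (1 / 2 * J)"
    unfolding T_def J_def by (intro sums_mult integral_zeta_termwise(2) assms)
  have bound: "norm ((\<Sum>k<M. nu_term \<omega> (k + 2)) - 1 / 2 * J) \<le> Z / (real M + 1 / 2)" for M
  proof -
    define D where "D n = T n - (\<Sum>k<M. (- 1) ^ k * (zeta_summand n (of_nat (k + 2)) / (of_nat (k + 2) + \<omega>)))" for n
    \<comment> \<open>The sum over \<open>k\<close> is finite, so it passes through the series over
      \<open>n\<close> by linearity; the exponents \<open>k + 2\<close> start at 2, where the
      Dirichlet series converges.\<close>
    have "D sums (1 / 2 * J - (\<Sum>k<M. (- 1) ^ k * (zeta (of_nat (k + 2)) / (of_nat (k + 2) + \<omega>))))"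
      unfolding D_def by (intro sums_diff T sums_sum sums_mult sums_divide zeta_sums) simp
    hence D: "D sums (1 / 2 * J - (\<Sum>k<M. nu_term \<omega> (k + 2)))"
      by (simp add: nu_term_def)
    have le: "norm (D n) \<le> real (Suc n) powr - 2 / (real M + 1 / 2)" for n
      using laplace_geometric_remainder[OF assms(1), of n M] mellin_barnes_summand[OF assms, of n]
      by (simp add: D_def T_def)
    have Z': "(\<lambda>n. real (Suc n) powr - 2 / (real M + 1 / 2)) sums (Z / (real M + 1 / 2))"
      by (intro sums_divide Z)
    have "norm (\<Sum>n. D n) \<le> (\<Sum>n. real (Suc n) powr - 2 / (real M + 1 / 2))"
      by (rule norm_suminf_le[OF le sums_summable[OF Z']])
    thus ?thesis
      using sums_unique[OF D] sums_unique[OF Z'] by (simp add: norm_minus_commute)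
  qed
  have lim: "(\<lambda>M. Z / (real M + 1 / 2)) \<longlonglongrightarrow> 0"
    unfolding add.commute[of _ "1 / 2"]
    by (intro tendsto_divide_0[OF tendsto_const] filterlim_at_top_imp_at_infinity
          filterlim_tendsto_add_at_top[OF tendsto_const filterlim_real_sequentially])
  have "(\<lambda>M. (\<Sum>k<M. nu_term \<omega> (k + 2)) - 1 / 2 * J) \<longlonglongrightarrow> 0"
    by (rule Lim_null_comparison[OF _ lim]) (intro always_eventually allI bound)
  \<comment> \<open>The error \<open>Z / (M + 1/2)\<close> gives convergence of the ordered partial
    sums, so summability and the value of \<open>nu\<close> come out together.\<close>
  hence nu_sums: "(\<lambda>k. nu_term \<omega> (k + 2)) sums (1 / 2 * J)"
    unfolding sums_def by (rule LIM_zero_cancel)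
  show ?thesis
    using integral_zeta_termwise(1)[OF assms(1), of \<sigma>] sums_summable[OF nu_sums] sums_unique[OF nu_sums]
    by (simp add: nu_def J_def)
qed

end
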